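(* Let $f:\mathbb{Z}^{+}\to\mathbb{C}$ be any function and let $g_f(m)=\sum_{d\mid m} f(d)$ for $m\ge1$. Then for all $n\ge 1$, $$g_f(n+1)=\sum_{b=\pm1}\ \sum_{k=1}^{\left\lfloor\frac{\sqrt{24n+1}-b}{6}\right\rfloor}(-1)^{k+1}\,g_f\!\left(n+1-\frac{k(3k+b)}{2}\right)+a_f(n+1),$$ where the sequence $a_f$ is defined in the context.
   Context: The pair $(f,g_f)$ is related by the Lambert series $\sum_{n\ge1} \frac{f(n)q^n}{1-q^n}=\sum_{m\ge1} g_f(m)q^m$ (equivalently $g_f(m)=\sum_{d\mid m}f(d)$). Iverson bracket: $[P]_\delta=1$ if the condition $P$ is true and $0$ otherwise. For integers $n,i\ge 1$ define $$a_{n,i} = \sum_{b=\pm1}\ \sum_{s=0}^{\lfloor n/i\rfloor-1} (-1)^{\left\lfloor \frac{\sqrt{24(n-(s+1)i)+1}-b}{6}\right\rfloor}\left[\frac{\sqrt{24(n-(s+1)i)+1}-b}{6}\in\mathbb{Z}\right]_\delta ,$$ i.e. $a_{n,i}$ is the sum of $(-1)^k$ over all ways of writing $n=(s+1)i+\frac{k(3k\pm1)}{2}$ with integers $k,s\ge0$ (for each $s$, the value $k=0$ is counted only once, not once for each sign). For integers $n\ge0$ define $$a_f(n)=\sum_{i=1}^{n} f(i)\,a_{n,i}+[n=0]_\delta .$$ *)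

theory Defs
  imports Complex_Main
begin

text \<open>
  Functions on the positive integers are total functions on \<open>nat\<close>; the value at \<open>0\<close> is
  never used, because only positive \<open>m\<close> (hence positive divisors \<open>d\<close>) matter below.
\<close>

definition lambert_coeff :: "(nat \<Rightarrow> complex) \<Rightarrow> nat \<Rightarrow> complex" where
  "lambert_coeff f m = (\<Sum>d | d dvd m. f d)"

text \<open>
  \<open>pent_root b x\<close> is \<open>(sqrt (24 x + 1) - b) / 6\<close>, the larger solution \<open>k\<close> of
  \<open>k (3 k + b) / 2 = x\<close> for \<open>b = 1\<close> or \<open>b = -1\<close>.
\<close>

definition pent_root :: "int \<Rightarrow> int \<Rightarrow> real" where
  "pent_root b x = (sqrt (24 * real_of_int x + 1) - real_of_int b) / 6"

text \<open>
  The subtraction \<open>n - (s + 1) i\<close> is taken in the integers; it is nonnegative in the range of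
  summation. The sum over \<open>s\<close> is empty for \<open>i > n\<close>.
\<close>

definition a_coeff :: "nat \<Rightarrow> nat \<Rightarrow> complex" where
  "a_coeff n i =
     (\<Sum>b\<in>{1, -1}. \<Sum>s = 0..<n div i.
        (-1) powi \<lfloor>pent_root b (int n - (int s + 1) * int i)\<rfloor>
          * of_bool (pent_root b (int n - (int s + 1) * int i) \<in> \<int>))"

definition a_seq :: "(nat \<Rightarrow> complex) \<Rightarrow> nat \<Rightarrow> complex" where
  "a_seq f n = (\<Sum>i = 1..n. f i * a_coeff n i) + of_bool (n = 0)"

end

theory Submission
  imports Defs
begin

text \<open>
  Write \<open>g\<close> for the divisor sum of \<open>f\<close> and \<open>N = n + 1\<close>. The value \<open>a_seq f N\<close> and the
  alternating sum in the recurrence both come from one sum, that of \<open>(-1)\<^sup>k g (N - x)\<close> over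
  all generalized pentagonal numbers \<open>x = k (3 k + b) / 2 < N\<close>, where \<open>b = 1\<close> and \<open>k \<ge> 0\<close>,
  or \<open>b = -1\<close> and \<open>k \<ge> 1\<close>.

  On the one hand, a pair \<open>(i, s)\<close> with \<open>i \<ge> 1\<close>, \<open>s \<ge> 0\<close> and \<open>(s + 1) i \<le> N\<close> is the same as
  a positive \<open>m \<le> N\<close> with a divisor \<open>i\<close>, where \<open>m = (s + 1) i\<close>; collecting terms by
  \<open>m = N - x\<close> shows that \<open>a_seq f N\<close> equals the sum above
  (\<open>sum_multiples_eq_sum_divisors\<close>, \<open>a_seq_eq\<close>). On the other hand, \<open>k \<mapsto> k (3 k + b) / 2\<close> is
  a bijection onto the \<open>x \<ge> 0\<close> at which \<open>pent_root b\<close> is an integer, with inverse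
  \<open>pent_root b\<close> (\<open>sum_pent_root_reindex\<close>), so the sum may be taken over \<open>k\<close>. Its term
  \<open>b = 1\<close>, \<open>k = 0\<close> is \<open>g N\<close>, and moving the terms with \<open>k \<ge> 1\<close> to the other side gives the
  recurrence. Euler's pentagonal number theorem is not needed.
\<close>

lemma sum_multiples_eq_sum_divisors:
  fixes h :: "nat \<Rightarrow> nat \<Rightarrow> 'a :: comm_monoid_add"
  shows "(\<Sum>i = 1..N. \<Sum>s = 0..<N div i. h i ((s + 1) * i)) = (\<Sum>m = 1..N. \<Sum>i | i dvd m. h i m)"
proof -
  have "(\<Sum>i = 1..N. \<Sum>s = 0..<N div i. h i ((s + 1) * i))
          = (\<Sum>(i, s)\<in>(SIGMA i:{1..N}. {0..<N div i}). h i ((s + 1) * i))"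
    by (simp add: sum.Sigma)
  also have "\<dots> = (\<Sum>(m, i)\<in>(SIGMA m:{1..N}. {i. i dvd m}). h i m)"
  proof (rule sum.reindex_bij_witness[where i = "\<lambda>(m, i). (i, m div i - 1)"
                                        and j = "\<lambda>(i, s). ((s + 1) * i, i)"])
    fix p assume "p \<in> (SIGMA i:{1..N}. {0..<N div i})"
    then obtain i s where p: "p = (i, s)" and i: "1 \<le> i" and s: "s + 1 \<le> N div i"
      by auto
    have "(s + 1) * i \<le> N"
      using i s by (simp add: less_eq_div_iff_mult_less_eq del: mult_Suc)
    then show "(case p of (i, s) \<Rightarrow> ((s + 1) * i, i)) \<in> (SIGMA m:{1..N}. {i. i dvd m})"
      using i p by auto
    show "(case case p of (i, s) \<Rightarrow> ((s + 1) * i, i) of (m, i) \<Rightarrow> (i, m div i - 1)) = p"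
      using i by (simp add: p del: mult_Suc)
  next
    fix p assume "p \<in> (SIGMA m:{1..N}. {i. i dvd m})"
    then obtain m i where p: "p = (m, i)" and m: "1 \<le> m" "m \<le> N" and dvd: "i dvd m"
      by auto
    from dvd m have i: "1 \<le> i" "i \<le> m"
      by (auto intro: dvd_imp_le simp: Suc_le_eq dvd_pos_nat)
    have quot: "1 \<le> m div i" "m div i \<le> N div i"
      using i div_le_mono[OF m(2)] by (simp_all add: Suc_le_eq div_greater_zero_iff)
    show "(case p of (m, i) \<Rightarrow> (i, m div i - 1)) \<in> (SIGMA i:{1..N}. {0..<N div i})"
      using i m quot by (auto simp: p)
    show "(case case p of (m, i) \<Rightarrow> (i, m div i - 1) of (i, s) \<Rightarrow> ((s + 1) * i, i)) = p"
      using quot dvd by (simp add: p del: mult_Suc)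
  qed auto
  also have "\<dots> = (\<Sum>m = 1..N. \<Sum>i | i dvd m. h i m)"
    by (rule sum.Sigma[symmetric]) auto
  finally show ?thesis .
qed

lemma a_seq_eq:
  assumes "N \<ge> 1"
  shows "a_seq f N = (\<Sum>b\<in>{1, -1}. \<Sum>x = 0..int N - 1.
           (-1) powi \<lfloor>pent_root b x\<rfloor> * of_bool (pent_root b x \<in> \<int>) * lambert_coeff f (nat (int N - x)))"
proof -
  define e :: "int \<Rightarrow> int \<Rightarrow> complex"
    where "e b x = (-1) powi \<lfloor>pent_root b x\<rfloor> * of_bool (pent_root b x \<in> \<int>)" for b x
  have int_mult: "int ((s + 1) * i) = (int s + 1) * int i" for s i
    by (simp add: distrib_right)
  have "a_seq f N = (\<Sum>i = 1..N. \<Sum>b\<in>{1, -1}. \<Sum>s = 0..<N div i. f i * e b (int N - int ((s + 1) * i)))"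
    using assms unfolding a_seq_def a_coeff_def e_def int_mult sum_distrib_left by simp
  also have "\<dots> = (\<Sum>b\<in>{1, -1}. \<Sum>i = 1..N. \<Sum>s = 0..<N div i. f i * e b (int N - int ((s + 1) * i)))"
    by (rule sum.swap)
  also have "\<dots> = (\<Sum>b\<in>{1, -1}. \<Sum>m = 1..N. \<Sum>i | i dvd m. f i * e b (int N - int m))"
    by (subst sum_multiples_eq_sum_divisors) (rule refl)
  also have "\<dots> = (\<Sum>b\<in>{1, -1}. \<Sum>m = 1..N. e b (int N - int m) * lambert_coeff f m)"
    unfolding lambert_coeff_def sum_distrib_left by (simp add: mult.commute)
  also have "\<dots> = (\<Sum>b\<in>{1, -1}. \<Sum>x = 0..int N - 1. e b x * lambert_coeff f (nat (int N - x)))"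
    by (intro sum.cong refl
          sum.reindex_bij_witness[where i = "\<lambda>x. nat (int N - x)" and j = "\<lambda>m. int N - int m"])
       auto
  finally show ?thesis
    unfolding e_def .
qed

lemma pent_root_mono: "x \<le> y \<Longrightarrow> pent_root b x \<le> pent_root b y"
  by (simp add: pent_root_def divide_right_mono)

lemma two_times_pentagonal:
  fixes b k :: int
  assumes "b \<in> {1, -1}"
  shows "2 * (k * (3 * k + b) div 2) = k * (3 * k + b)"
  using assms by (intro dvd_mult_div_cancel) auto

text \<open>
  The lower bound \<open>(1 - b) / 2\<close> is \<open>0\<close> for \<open>b = 1\<close> and \<open>1\<close> for \<open>b = -1\<close>: the pentagonal number
  \<open>0\<close> is represented for \<open>b = 1\<close> only.
\<close>

lemma pent_root_pentagonal:
  assumes b: "b \<in> {1, -1}" and k: "(1 - b) div 2 \<le> k"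
  shows "pent_root b (k * (3 * k + b) div 2) = of_int k"
proof -
  define x where "x = k * (3 * k + b) div 2"
  have "2 * x = k * (3 * k + b)"
    unfolding x_def by (rule two_times_pentagonal[OF b])
  then have "24 * x + 1 = (6 * k + b)\<^sup>2"
    using b by (auto simp: power2_eq_square algebra_simps)
  then have "24 * real_of_int x + 1 = (of_int (6 * k + b))\<^sup>2"
    by (metis of_int_1 of_int_add of_int_mult of_int_numeral of_int_power)
  moreover have "0 \<le> 6 * k + b"
    using b k by auto
  ultimately have "sqrt (24 * real_of_int x + 1) = of_int (6 * k + b)"
    by (metis of_int_0_le_iff real_sqrt_unique)
  then show ?thesis
    by (simp add: pent_root_def flip: x_def)
qed

lemma pent_root_eq_of_intD:
  assumes b: "b \<in> {1, -1}" and x: "0 \<le> x" and root: "pent_root b x = of_int k"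
  shows "x = k * (3 * k + b) div 2" and "(1 - b) div 2 \<le> k"
proof -
  have sqrt: "sqrt (24 * real_of_int x + 1) = of_int (6 * k + b)"
    using root by (simp add: pent_root_def)
  have "real_of_int (24 * x + 1) = of_int ((6 * k + b)\<^sup>2)"
    using arg_cong[OF sqrt, of "\<lambda>t. t\<^sup>2"] x by simp
  then have "24 * x + 1 = (6 * k + b)\<^sup>2"
    by (simp only: of_int_eq_iff)
  then have "2 * x = k * (3 * k + b)"
    using b by (auto simp: power2_eq_square algebra_simps)
  then show "x = k * (3 * k + b) div 2"
    by simp
  have "1 \<le> real_of_int (6 * k + b)"
    unfolding sqrt[symmetric] using x by simp
  then have "1 \<le> 6 * k + b"
    by linarith
  then show "(1 - b) div 2 \<le> k"
    using b by auto
qed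

lemma sum_pent_root_reindex:
  fixes G :: "int \<Rightarrow> complex"
  assumes b: "b \<in> {1, -1}"
  shows "(\<Sum>x = 0..n. (-1) powi \<lfloor>pent_root b x\<rfloor> * of_bool (pent_root b x \<in> \<int>) * G x)
           = (\<Sum>k = (1 - b) div 2..\<lfloor>pent_root b n\<rfloor>. (-1) powi k * G (k * (3 * k + b) div 2))"
proof -
  have "(\<Sum>x = 0..n. (-1) powi \<lfloor>pent_root b x\<rfloor> * of_bool (pent_root b x \<in> \<int>) * G x)
          = (\<Sum>x\<in>{x \<in> {0..n}. pent_root b x \<in> \<int>}. (-1) powi \<lfloor>pent_root b x\<rfloor> * G x)"
    by (rule sum.mono_neutral_cong_right) auto
  also have "\<dots> = (\<Sum>k = (1 - b) div 2..\<lfloor>pent_root b n\<rfloor>. (-1) powi k * G (k * (3 * k + b) div 2))"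
  proof (rule sum.reindex_bij_witness[where i = "\<lambda>k. k * (3 * k + b) div 2"
                                        and j = "\<lambda>x. \<lfloor>pent_root b x\<rfloor>"])
    fix x assume x: "x \<in> {x \<in> {0..n}. pent_root b x \<in> \<int>}"
    then have root: "pent_root b x = of_int \<lfloor>pent_root b x\<rfloor>"
      by (auto elim: Ints_cases)
    note * = pent_root_eq_of_intD[OF b _ root]
    show "\<lfloor>pent_root b x\<rfloor> * (3 * \<lfloor>pent_root b x\<rfloor> + b) div 2 = x"
      using * x by simp
    then show "(-1) powi \<lfloor>pent_root b x\<rfloor> * G (\<lfloor>pent_root b x\<rfloor> * (3 * \<lfloor>pent_root b x\<rfloor> + b) div 2)
                 = (-1) powi \<lfloor>pent_root b x\<rfloor> * G x"
      by simp
    show "\<lfloor>pent_root b x\<rfloor> \<in> {(1 - b) div 2..\<lfloor>pent_root b n\<rfloor>}"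
      using * x by (auto intro: floor_mono pent_root_mono)
  next
    fix k assume k: "k \<in> {(1 - b) div 2..\<lfloor>pent_root b n\<rfloor>}"
    then have root: "pent_root b (k * (3 * k + b) div 2) = of_int k"
      by (intro pent_root_pentagonal b) simp
    then show "\<lfloor>pent_root b (k * (3 * k + b) div 2)\<rfloor> = k"
      by simp
    have "0 \<le> k * (3 * k + b)"
      using b k by (intro mult_nonneg_nonneg) auto
    moreover have "k * (3 * k + b) div 2 \<le> n"
    proof (rule ccontr)
      assume "\<not> ?thesis"
      then have "sqrt (24 * real_of_int n + 1) < sqrt (24 * real_of_int (k * (3 * k + b) div 2) + 1)"
        by simp
      then have "pent_root b n < of_int k"
        unfolding root[symmetric] pent_root_def by simp
      with k show False
        by (simp add: le_floor_iff)
    qed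
    ultimately show "k * (3 * k + b) div 2 \<in> {x \<in> {0..n}. pent_root b x \<in> \<int>}"
      using root by simp
  qed
  finally show ?thesis .
qed

theorem theorem1p4:
  fixes f :: "nat \<Rightarrow> complex" and n :: nat
  assumes "n \<ge> 1"
  shows "lambert_coeff f (n + 1) =
           (\<Sum>b\<in>{1, -1 :: int}. \<Sum>k = 1..\<lfloor>pent_root b (int n)\<rfloor>.
              (-1) powi (k + 1)
                * lambert_coeff f (nat (int n + 1 - k * (3 * k + b) div 2)))
           + a_seq f (n + 1)"
proof -
  define T :: "int \<Rightarrow> int \<Rightarrow> complex"
    where "T b k = (-1) powi k * lambert_coeff f (nat (int n + 1 - k * (3 * k + b) div 2))" for b k
  have "a_seq f (n + 1) = (\<Sum>b\<in>{1, -1}. \<Sum>x = 0..int n. (-1) powi \<lfloor>pent_root b x\<rfloor>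
          * of_bool (pent_root b x \<in> \<int>) * lambert_coeff f (nat (int n + 1 - x)))"
    by (subst a_seq_eq) (simp_all add: algebra_simps)
  also have "\<dots> = (\<Sum>b\<in>{1, -1}. \<Sum>k = (1 - b) div 2..\<lfloor>pent_root b (int n)\<rfloor>. T b k)"
    unfolding T_def by (intro sum.cong refl sum_pent_root_reindex)
  also have "\<dots> = (\<Sum>k = 0..\<lfloor>pent_root 1 (int n)\<rfloor>. T 1 k) + (\<Sum>k = 1..\<lfloor>pent_root (-1) (int n)\<rfloor>. T (-1) k)"
    by simp
  also have "(\<Sum>k = 0..\<lfloor>pent_root 1 (int n)\<rfloor>. T 1 k) = T 1 0 + (\<Sum>k = 1..\<lfloor>pent_root 1 (int n)\<rfloor>. T 1 k)"
  proof -
    have "{0..\<lfloor>pent_root 1 (int n)\<rfloor>} = insert 0 {1..\<lfloor>pent_root 1 (int n)\<rfloor>}"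
      by (auto simp: pent_root_def)
    then show ?thesis
      by simp
  qed
  also have "T 1 0 = lambert_coeff f (n + 1)"
    by (simp add: T_def nat_add_distrib)
  finally have a_seq: "a_seq f (n + 1) = lambert_coeff f (n + 1)
      + (\<Sum>k = 1..\<lfloor>pent_root 1 (int n)\<rfloor>. T 1 k) + (\<Sum>k = 1..\<lfloor>pent_root (-1) (int n)\<rfloor>. T (-1) k)" .
  have neg: "(-1) powi (k + 1) * lambert_coeff f (nat (int n + 1 - k * (3 * k + b) div 2)) = - T b k"
    for b k
    by (simp add: T_def power_int_add)
  show ?thesis
    unfolding neg a_seq by (simp add: sum_negf)
qed

end
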